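(* Let $K$ be a complete ultrametric field, let $\lambda\in K$ with $0<|\lambda|<1$, let $\rho>0$ be a real number, and let $f\in\mathcal{F}_{\lambda,\rho}(K)$, i.e. $f(x)=\lambda x+\sum_{i=2}^{\infty}a_i x^i\in K[[x]]$ with $1/\sup_{i\geq 2}|a_i|^{1/(i-1)}=\rho$. Then there is a unique function $g$, defined on the open disc $\{x\in K: |x|<\rho\}$, with $g(0)=0$ and $g'(0)=1$, such that the semi-conjugacy $$g\circ f(x)=\lambda g(x)$$ is valid in the open disc $\{x\in K: |x|<\rho\}$. The full conjugacy $$g\circ f\circ g^{-1}(x)=\lambda x$$ holds for $|x|<|\lambda|\rho$.
   Context: $K$ is a field complete with respect to an ultrametric (non-Archimedean) absolute value $|\cdot|$; it may have any characteristic and its residue field may have any characteristic. For $\lambda\in K$, $\lambda\ne 0$, and a real number $\rho>0$, $$\mathcal{F}_{\lambda,\rho}(K)=\Big\{f\in K[[x]]: f(x)=\lambda x+\sum_{i=2}^{\infty}a_i x^i,\ 1/\sup_{i\ge 2}|a_i|^{1/(i-1)}=\rho\Big\}.$$ Functions on discs about the origin here are those given by convergent power series over $K$ centred at $0$, and $f$ is regarded as the function defined by its power series. $g^{-1}$ denotes the local inverse of $g$ fixing the origin (the compositional inverse power series). To say that the full conjugacy holds for $|x|<r$ means that for all $x\in K$ with $|x|<r$ the left-hand side $g(f(g^{-1}(x)))$ is defined and equals $\lambda x$. *)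

theory Defs
  imports "HOL-Analysis.Analysis" "HOL-Computational_Algebra.Formal_Power_Series"
begin

text \<open>
  The library's \<open>real_normed_field\<close> contains the reals and is therefore never ultrametric,
  and the library reserves the overloaded \<open>norm\<close> for \<open>real_normed_vector\<close>; so the absolute value
  is a parameter of its own.  The topology is that of the metric \<open>absval (x - y)\<close>; completeness is
  expressed by the library class \<open>complete_space\<close>.
\<close>

class ultrametric_field = field + metric_space +
  fixes absval :: "'a \<Rightarrow> real"
  assumes dist_absval: "dist x y = absval (x - y)"
    and absval_nonneg: "0 \<le> absval x"
    and absval_eq_0: "absval x = 0 \<longleftrightarrow> x = 0"
    and absval_mult: "absval (x * y) = absval x * absval y"
    and absval_add_le_max: "absval (x + y) \<le> max (absval x) (absval y)"

definition open_disc :: "real \<Rightarrow> 'a::ultrametric_field set" where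
  "open_disc r = {x. absval x < r}"

definition fps_converges_at :: "'a::ultrametric_field fps \<Rightarrow> 'a \<Rightarrow> bool" where
  "fps_converges_at F x \<longleftrightarrow> summable (\<lambda>n. fps_nth F n * x ^ n)"

definition fps_value :: "'a::ultrametric_field fps \<Rightarrow> 'a \<Rightarrow> 'a" where
  "fps_value F x = (\<Sum>n. fps_nth F n * x ^ n)"

definition fps_represents :: "'a::ultrametric_field fps \<Rightarrow> ('a \<Rightarrow> 'a) \<Rightarrow> real \<Rightarrow> bool" where
  "fps_represents G g r \<longleftrightarrow>
     (\<forall>x \<in> open_disc r. fps_converges_at G x \<and> g x = fps_value G x)"

text \<open>
  The supremum is taken in the extended reals, where \<open>1 / 0 = \<infinity>\<close> and \<open>1 / \<infinity> = 0\<close>.  For real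
  \<open>\<rho> > 0\<close> the equation thus says that the supremum is finite, nonzero and equal to \<open>1 / \<rho>\<close>.
\<close>

definition power_series_family :: "'a::ultrametric_field \<Rightarrow> real \<Rightarrow> 'a fps set" where
  "power_series_family l \<rho> =
     {f. fps_nth f 0 = 0 \<and> fps_nth f 1 = l \<and>
         1 / (SUP i\<in>{2..}. ereal (root (i - 1) (absval (fps_nth f i)))) = ereal \<rho>}"

text \<open>
  A function on the disc is encoded as a total function with value \<open>undefined\<close> off the disc
  (\<open>extensional\<close>), so that equality of such functions is equality on the disc.
\<close>

definition semi_conjugacy :: "'a::ultrametric_field fps \<Rightarrow> 'a \<Rightarrow> real \<Rightarrow> ('a \<Rightarrow> 'a) \<Rightarrow> bool" where
  "semi_conjugacy f l \<rho> g \<longleftrightarrow>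
     g \<in> extensional (open_disc \<rho>) \<and>
     (\<exists>G. fps_represents G g \<rho>) \<and>
     g 0 = 0 \<and> ((\<lambda>x. (g x - g 0) / (x - 0)) \<longlongrightarrow> 1) (at 0) \<and>
     (\<forall>x \<in> open_disc \<rho>.
        fps_converges_at f x \<and> fps_value f x \<in> open_disc \<rho> \<and> g (fps_value f x) = l * g x)"

text \<open>
  The power series \<open>G\<close> of \<open>g\<close> enters through its compositional inverse \<open>fps_inv G\<close>.  The first three
  conjuncts say that the left-hand side of the conjugacy is defined at \<open>x\<close>.
\<close>

definition full_conjugacy_at ::
    "'a::ultrametric_field fps \<Rightarrow> 'a \<Rightarrow> real \<Rightarrow> ('a \<Rightarrow> 'a) \<Rightarrow> 'a fps \<Rightarrow> 'a \<Rightarrow> bool" where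
  "full_conjugacy_at f l \<rho> g G x \<longleftrightarrow>
     fps_converges_at (fps_inv G) x \<and>
     fps_converges_at f (fps_value (fps_inv G) x) \<and>
     fps_value f (fps_value (fps_inv G) x) \<in> open_disc \<rho> \<and>
     g (fps_value f (fps_value (fps_inv G) x)) = l * x"

end

theory Submission
  imports Defs
begin

text \<open>
  The function \<open>g\<close> is the Koenigs linearization of \<open>f\<close>, and it is found as a power series \<open>G\<close> with
  \<open>G oo f = l * G\<close>, the equation of Schroeder.  In \<open>G oo f\<close> the coefficient of degree \<open>k\<close> is
  \<open>G $ k * l ^ k\<close> plus terms in the earlier coefficients of \<open>G\<close>, so the equation is the recurrence
  \<open>(l - l ^ k) * G $ k = (\<Sum>j<k. G $ j * (f ^ j) $ k)\<close>.  From \<open>G $ 0 = 0\<close> and \<open>G $ 1 = 1\<close> it determines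
  \<open>G\<close>, since for \<open>k \<ge> 2\<close> the divisor satisfies \<open>\<bar>l - l ^ k\<bar> = \<bar>l\<bar>\<close>: there are no small divisors.

  The difficulty is that \<open>G\<close> must converge on the whole disc of radius \<open>\<rho>\<close>, whereas losing a factor
  \<open>1 / \<bar>l\<bar>\<close> at each of the \<open>k - 1\<close> steps of the recurrence yields only the radius \<open>\<bar>l\<bar> * \<rho>\<close>.  The
  remedy is to estimate the coefficients of \<open>f ^ j\<close> at two radii.  The supremum of
  \<open>\<bar>f $ i\<bar> * r ^ i\<close> is at most \<open>\<rho>\<close> for \<open>r = \<rho>\<close>, and at most \<open>\<bar>l\<bar>\<^sup>2 * \<rho>\<close> for \<open>r = \<bar>l\<bar> * \<rho>\<close>; these suprema
  are submultiplicative (\<open>absval_fps_power_nth_le\<close>).  The second bound says that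
  \<open>\<bar>(f ^ j) $ k\<bar> * \<rho> ^ k \<le> \<bar>l\<bar> ^ (2 * j - k) * \<rho> ^ j\<close>, which for \<open>k < 2 * j\<close> pays for the division by
  \<open>\<bar>l\<bar>\<close>.  Hence a factor \<open>1 / \<bar>l\<bar>\<close> is lost only when the index at least doubles, that is, at most
  \<open>log 2 k\<close> times, and \<open>\<bar>G $ k\<bar> * \<rho> ^ k\<close> grows at most polynomially in \<open>k\<close>
  (\<open>schroeder_nth_le_polynomial\<close>).

  To pass between series and functions one needs that the value of \<open>G oo f\<close> at \<open>x\<close> is the value of \<open>G\<close>
  at \<open>f x\<close> (\<open>fps_value_compose\<close>), and that a series is determined by its values
  (\<open>fps_represents_unique\<close>).  The first is an exchange of summations: in a complete ultrametric field
  a family that tends to \<open>0\<close> is unconditionally summable, whatever its index set.  The second uses that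
  the absolute value is nontrivial, which holds because \<open>0 < \<bar>l\<bar> < 1\<close>.  Together they show that every
  series representing a solution \<open>g\<close> solves the equation of Schroeder, so that \<open>g\<close> is unique.

  For the full conjugacy, the crude bound on the coefficients of \<open>G\<close> is the right one: with
  \<open>s = \<bar>l\<bar> * \<rho>\<close> it reads \<open>\<bar>G $ k\<bar> * s ^ k \<le> s\<close>, and the compositional inverse of \<open>G\<close> inherits it.  The
  inverse therefore maps the disc of radius \<open>s\<close> into itself, where \<open>g\<close> undoes it, and
  \<open>g (f (g\<^sup>-\<^sup>1 x)) = l * g (g\<^sup>-\<^sup>1 x) = l * x\<close>.
\<close>

unbundle no vec_syntax
unbundle fps_syntax

section \<open>Ultrametric fields as topological rings\<close>

lemma absval_0 [simp]: "absval (0::'a::ultrametric_field) = 0"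
  by (simp add: absval_eq_0)

lemma absval_1 [simp]: "absval (1::'a::ultrametric_field) = 1"
  using absval_mult[of "1::'a" 1] absval_eq_0[of "1::'a"] by simp

lemma absval_power: "absval (x ^ n) = absval (x::'a::ultrametric_field) ^ n"
  by (induction n) (auto simp: absval_mult)

lemma absval_eq_dist: "absval (x::'a::ultrametric_field) = dist x 0"
  by (simp add: dist_absval)

lemma absval_minus [simp]: "absval (- x) = absval (x::'a::ultrametric_field)"
  by (metis absval_eq_dist dist_absval dist_commute diff_0)

lemma absval_diff_le_max: "absval (x - y) \<le> max (absval x) (absval (y::'a::ultrametric_field))"
  using absval_add_le_max[of x "- y"] by simp

lemma absval_sum_le:
  fixes f :: "'b \<Rightarrow> 'a::ultrametric_field"
  assumes "0 \<le> B" and "\<And>i. i \<in> A \<Longrightarrow> absval (f i) \<le> B"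
  shows "absval (sum f A) \<le> B"
  using assms
proof (induction A rule: infinite_finite_induct)
  case (insert i A)
  then show ?case
    using absval_add_le_max[of "f i" "sum f A"] by fastforce
qed auto

lemma tendsto_absval_diff_0_iff:
  fixes f :: "'b \<Rightarrow> 'a::ultrametric_field"
  shows "(f \<longlongrightarrow> a) F \<longleftrightarrow> ((\<lambda>i. absval (f i - a)) \<longlongrightarrow> 0) F"
  by (subst tendsto_dist_iff) (simp add: dist_absval)

lemma tendsto_absval:
  fixes f :: "'b \<Rightarrow> 'a::ultrametric_field"
  assumes "(f \<longlongrightarrow> a) F"
  shows "((\<lambda>i. absval (f i)) \<longlongrightarrow> absval a) F"
  unfolding absval_eq_dist using assms by (intro tendsto_intros)

text \<open>
  The topology comes from the metric alone; the continuity of the ring operations makes the general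
  theory of limits and of sums over arbitrary index sets available.
\<close>

instance ultrametric_field \<subseteq> topological_ab_group_add
proof
  fix a b :: 'a
  show "((\<lambda>x. fst x + snd x) \<longlongrightarrow> a + b) (nhds a \<times>\<^sub>F nhds b)"
  proof (subst tendsto_absval_diff_0_iff, rule tendsto_sandwich[OF _ _ tendsto_const])
    have "(fst \<longlongrightarrow> a) (nhds a \<times>\<^sub>F nhds b)" "(snd \<longlongrightarrow> b) (nhds a \<times>\<^sub>F nhds b)"
      by (auto intro: filterlim_fst filterlim_snd)
    then have "((\<lambda>x. max (absval (fst x - a)) (absval (snd x - b))) \<longlongrightarrow> max 0 0)
        (nhds a \<times>\<^sub>F nhds b)"
      by (intro tendsto_max) (simp_all add: tendsto_absval_diff_0_iff)
    then show "((\<lambda>x. max (absval (fst x - a)) (absval (snd x - b))) \<longlongrightarrow> 0)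
        (nhds a \<times>\<^sub>F nhds b)"
      by simp
    show "\<forall>\<^sub>F x in nhds a \<times>\<^sub>F nhds b. absval (fst x + snd x - (a + b))
        \<le> max (absval (fst x - a)) (absval (snd x - b))"
      using absval_add_le_max[of "fst x - a" "snd x - b" for x]
      by (intro always_eventually) (simp add: algebra_simps)
  qed (auto simp: absval_nonneg)
  have "absval (- x - - a) = absval (x - a)" for x
    using absval_minus[of "x - a"] by (simp add: algebra_simps)
  then show "(uminus \<longlongrightarrow> - a) (nhds a)"
    using filterlim_ident[of "nhds a"]
    by (subst tendsto_absval_diff_0_iff) (simp add: tendsto_absval_diff_0_iff[of "\<lambda>x. x"])
qed

instance ultrametric_field \<subseteq> topological_semigroup_mult
proof
  fix a b :: 'a
  show "((\<lambda>x. fst x * snd x) \<longlongrightarrow> a * b) (nhds a \<times>\<^sub>F nhds b)"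
  proof (subst tendsto_absval_diff_0_iff, rule tendsto_sandwich[OF _ _ tendsto_const])
    have fst: "(fst \<longlongrightarrow> a) (nhds a \<times>\<^sub>F nhds b)" and snd: "(snd \<longlongrightarrow> b) (nhds a \<times>\<^sub>F nhds b)"
      by (auto intro: filterlim_fst filterlim_snd)
    have "((\<lambda>x. max (absval (fst x - a) * absval (snd x)) (absval a * absval (snd x - b)))
        \<longlongrightarrow> max (0 * absval b) (absval a * 0)) (nhds a \<times>\<^sub>F nhds b)"
      using fst snd tendsto_absval[OF snd]
      by (intro tendsto_max tendsto_mult tendsto_const) (simp_all add: tendsto_absval_diff_0_iff)
    then show "((\<lambda>x. max (absval (fst x - a) * absval (snd x)) (absval a * absval (snd x - b)))
        \<longlongrightarrow> 0) (nhds a \<times>\<^sub>F nhds b)"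
      by simp
    show "\<forall>\<^sub>F x in nhds a \<times>\<^sub>F nhds b. absval (fst x * snd x - a * b)
        \<le> max (absval (fst x - a) * absval (snd x)) (absval a * absval (snd x - b))"
      using absval_add_le_max[of "(fst x - a) * snd x" "a * (snd x - b)" for x]
      by (intro always_eventually) (simp add: algebra_simps flip: absval_mult)
  qed (auto simp: absval_nonneg)
qed

text \<open>
  The powers of \<open>l\<close> are nonzero and tend to \<open>0\<close>, so the origin is not isolated.  Without this, limits at
  the origin would be meaningless and a power series would not be determined by its values.
\<close>

lemma at_0_neq_bot:
  fixes l :: "'a::ultrametric_field"
  assumes "0 < absval l" "absval l < 1"
  shows "at (0::'a) \<noteq> bot"
proof -
  have "(\<lambda>n. absval l ^ n) \<longlonglongrightarrow> 0"
    using assms by (intro LIMSEQ_realpow_zero) auto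
  then have "(\<lambda>n. l ^ n) \<longlonglongrightarrow> 0"
    by (simp add: tendsto_absval_diff_0_iff absval_power)
  moreover have "\<forall>n. l ^ n \<in> UNIV - {0}"
    using assms by auto
  ultimately have "(0::'a) islimpt UNIV"
    unfolding islimpt_sequential by blast
  then show ?thesis
    by (simp add: trivial_limit_within)
qed

section \<open>Unconditional summation\<close>

text \<open>
  Past the finitely many terms of size at least \<open>e\<close>, any further finite partial sum has size less
  than \<open>e\<close>, by the ultrametric inequality; the partial sums are thus a Cauchy net.
\<close>

lemma summable_on_ultrametric:
  fixes f :: "'b \<Rightarrow> 'a::{ultrametric_field, complete_space}"
  assumes "\<And>e. e > 0 \<Longrightarrow> finite {i \<in> A. e \<le> absval (f i)}"
  shows "f summable_on A"
proof -
  have "\<exists>P. eventually P (finite_subsets_at_top A) \<and>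
              (\<forall>F F'. P F \<and> P F' \<longrightarrow> dist (sum f F) (sum f F') < e)" if "e > 0" for e
  proof -
    define D where "D = {i \<in> A. e / 2 \<le> absval (f i)}"
    have D: "finite D" "D \<subseteq> A"
      unfolding D_def using assms[of "e / 2"] that by auto
    have near: "absval (sum f F - sum f D) \<le> e / 2" if "finite F" "D \<subseteq> F" "F \<subseteq> A" for F
    proof -
      have "sum f F - sum f D = sum f (F - D)"
        using that by (simp add: sum_diff)
      moreover have "absval (sum f (F - D)) \<le> e / 2"
        using that \<open>e > 0\<close> by (intro absval_sum_le) (auto simp: D_def)
      ultimately show ?thesis
        by simp
    qed
    have "dist (sum f F) (sum f F') < e"
      if "finite F" "D \<subseteq> F" "F \<subseteq> A" "finite F'" "D \<subseteq> F'" "F' \<subseteq> A" for F F'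
      using near[OF that(1-3)] near[OF that(4-6)] \<open>e > 0\<close>
        absval_diff_le_max[of "sum f F - sum f D" "sum f F' - sum f D"]
      by (simp add: dist_absval)
    moreover have "eventually (\<lambda>F. finite F \<and> D \<subseteq> F \<and> F \<subseteq> A) (finite_subsets_at_top A)"
      unfolding eventually_finite_subsets_at_top using D by blast
    ultimately show ?thesis
      by (intro exI[of _ "\<lambda>F. finite F \<and> D \<subseteq> F \<and> F \<subseteq> A"]) simp
  qed
  then have "cauchy_filter (filtermap (sum f) (finite_subsets_at_top A))"
    by (simp add: cauchy_filter_metric_filtermap)
  moreover have "complete (UNIV::'a set)"
    by (meson Cauchy_convergent UNIV_I complete_def convergent_def)
  ultimately obtain S where "(sum f \<longlongrightarrow> S) (finite_subsets_at_top A)"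
    using complete_uniform[where S=UNIV] by (force simp: filterlim_def)
  then show ?thesis
    using summable_on_def has_sum_def by blast
qed

lemma absval_has_sum_le:
  fixes f :: "'b \<Rightarrow> 'a::ultrametric_field"
  assumes "(f has_sum S) A" "0 \<le> B" "\<And>i. i \<in> A \<Longrightarrow> absval (f i) \<le> B"
  shows "absval S \<le> B"
proof (rule tendsto_upperbound)
  show "((\<lambda>F. absval (sum f F)) \<longlongrightarrow> absval S) (finite_subsets_at_top A)"
    using assms(1) unfolding has_sum_def by (rule tendsto_absval)
  show "\<forall>\<^sub>F F in finite_subsets_at_top A. absval (sum f F) \<le> B"
    using assms(2,3) by (intro eventually_finite_subsets_at_top_weakI absval_sum_le) auto
qed simp

lemma finite_superlevel_if_tendsto_0:
  fixes a :: "nat \<Rightarrow> real"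
  assumes "a \<longlonglongrightarrow> 0" "0 < e"
  shows "finite {n. e \<le> a n}"
proof -
  have "eventually (\<lambda>n. a n < e) sequentially"
    using assms by (rule order_tendstoD)
  then show ?thesis
    by (simp add: eventually_cofinite not_less flip: cofinite_eq_sequentially)
qed

text \<open>
  The hypothesis \<open>small\<close> makes the double family summable over all pairs, and both iterated sums equal
  this sum.
\<close>

lemma has_sum_exchange:
  fixes a :: "'b \<Rightarrow> 'c \<Rightarrow> 'a::{ultrametric_field, complete_space}"
  assumes small: "\<And>e. e > 0 \<Longrightarrow> finite {(i, j). e \<le> absval (a i j)}"
    and rows: "\<And>i. (a i has_sum r i) UNIV"
    and columns: "\<And>j. ((\<lambda>i. a i j) has_sum c j) UNIV"
  obtains S where "(r has_sum S) UNIV" "(c has_sum S) UNIV"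
proof -
  have "(\<lambda>(i, j). a i j) summable_on UNIV \<times> UNIV"
    using small by (intro summable_on_ultrametric) (simp add: case_prod_unfold)
  then obtain S where S: "((\<lambda>(i, j). a i j) has_sum S) (UNIV \<times> UNIV)"
    unfolding summable_on_def by blast
  have "(r has_sum S) UNIV"
    using rows by (intro has_sum_SigmaD[OF S]) simp
  moreover have "(c has_sum S) UNIV"
    using columns by (intro has_sum_SigmaD[OF has_sum_swap[THEN iffD1, OF S]]) simp
  ultimately show thesis
    by (rule that)
qed

section \<open>Values of power series\<close>

lemma fps_converges_at_iff:
  fixes F :: "'a::{ultrametric_field, complete_space} fps"
  shows "fps_converges_at F x \<longleftrightarrow> (\<lambda>n. absval (F $ n) * absval x ^ n) \<longlonglongrightarrow> 0"
proof
  assume "fps_converges_at F x"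
  then have "(\<lambda>n. \<Sum>i<n. F $ i * x ^ i) \<longlonglongrightarrow> fps_value F x"
    unfolding fps_converges_at_def fps_value_def by (simp add: summable_LIMSEQ)
  \<comment> \<open>The terms are differences of consecutive partial sums.\<close>
  from tendsto_diff[OF LIMSEQ_Suc[OF this] this] have "(\<lambda>n. F $ n * x ^ n) \<longlonglongrightarrow> 0"
    by simp
  then show "(\<lambda>n. absval (F $ n) * absval x ^ n) \<longlonglongrightarrow> 0"
    by (simp add: tendsto_absval_diff_0_iff absval_mult absval_power)
next
  assume "(\<lambda>n. absval (F $ n) * absval x ^ n) \<longlonglongrightarrow> 0"
  then have "(\<lambda>n. F $ n * x ^ n) summable_on UNIV"
    by (intro summable_on_ultrametric)
      (auto simp: absval_mult absval_power intro: finite_superlevel_if_tendsto_0)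
  then show "fps_converges_at F x"
    unfolding fps_converges_at_def by (rule summable_on_imp_summable)
qed

lemma fps_converges_at_if_le:
  fixes F :: "'a::{ultrametric_field, complete_space} fps"
  assumes "a \<longlonglongrightarrow> 0" "\<And>n. absval (F $ n) * absval x ^ n \<le> a n"
  shows "fps_converges_at F x"
  unfolding fps_converges_at_iff
proof (rule tendsto_sandwich[OF _ _ tendsto_const assms(1)])
  show "\<forall>\<^sub>F n in sequentially. 0 \<le> absval (F $ n) * absval x ^ n"
    by (simp add: absval_nonneg)
qed (simp add: assms(2))

lemma fps_value_has_sum:
  fixes F :: "'a::{ultrametric_field, complete_space} fps"
  assumes "fps_converges_at F x"
  shows "((\<lambda>n. F $ n * x ^ n) has_sum fps_value F x) UNIV"
proof -
  have "(\<lambda>n. F $ n * x ^ n) summable_on UNIV"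
    using assms unfolding fps_converges_at_iff
    by (intro summable_on_ultrametric)
      (auto simp: absval_mult absval_power intro: finite_superlevel_if_tendsto_0)
  then obtain s where s: "((\<lambda>n. F $ n * x ^ n) has_sum s) UNIV"
    unfolding summable_on_def by blast
  then have "fps_value F x = s"
    unfolding fps_value_def by (metis has_sum_imp_sums sums_unique)
  with s show ?thesis
    by simp
qed

lemma fps_value_unique:
  assumes "((\<lambda>n. F $ n * x ^ n) has_sum s) UNIV"
  shows "fps_converges_at F x" "fps_value F x = s"
  using has_sum_imp_sums[OF assms] unfolding fps_converges_at_def fps_value_def
  by (auto dest: sums_summable sums_unique)

lemma fps_value_sums:
  assumes "fps_converges_at F x"
  shows "(\<lambda>n. F $ n * x ^ n) sums fps_value F x"
  using assms unfolding fps_converges_at_def fps_value_def by (rule summable_sums)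

lemma fps_terms_bounded:
  fixes F :: "'a::{ultrametric_field, complete_space} fps"
  assumes "fps_converges_at F x"
  obtains M where "0 < M" "\<And>n. absval (F $ n) * absval x ^ n \<le> M"
proof -
  have "Bseq (\<lambda>n. absval (F $ n) * absval x ^ n)"
    using assms unfolding fps_converges_at_iff by (rule convergent_imp_Bseq[OF convergentI])
  then obtain M where "0 < M" "\<And>n. norm (absval (F $ n) * absval x ^ n) \<le> M"
    unfolding Bseq_def by auto
  with that[of M] show thesis
    by (auto simp: abs_le_iff)
qed

lemma absval_fps_value_le:
  fixes F :: "'a::{ultrametric_field, complete_space} fps"
  assumes "fps_converges_at F x" "\<And>n. absval (F $ n) * absval x ^ n \<le> B"
  shows "absval (fps_value F x) \<le> B"
proof (rule absval_has_sum_le[OF fps_value_has_sum[OF assms(1)]])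
  show "0 \<le> B"
    using assms(2)[of 0] absval_nonneg[of "F $ 0"] by simp
qed (use assms(2) in \<open>simp add: absval_mult absval_power\<close>)

lemma fps_value_0:
  "fps_converges_at F 0" "fps_value F 0 = F $ 0"
proof -
  have "((\<lambda>n. F $ n * 0 ^ n) has_sum F $ 0) UNIV"
    by (rule has_sum_finite_neutralI[of "{0}"]) auto
  from fps_value_unique[OF this] show "fps_converges_at F 0" "fps_value F 0 = F $ 0"
    by auto
qed

lemma fps_value_diff:
  assumes "fps_converges_at F x" "fps_converges_at G x"
  shows "fps_converges_at (F - G) x" "fps_value (F - G) x = fps_value F x - fps_value G x"
proof -
  have "(\<lambda>n. (F - G) $ n * x ^ n) sums (fps_value F x - fps_value G x)"
    using tendsto_diff[OF assms[THEN fps_value_sums, unfolded sums_def]]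
    by (simp add: sums_def sum_subtractf left_diff_distrib)
  then show "fps_converges_at (F - G) x" "fps_value (F - G) x = fps_value F x - fps_value G x"
    unfolding fps_converges_at_def fps_value_def by (simp_all add: sums_iff)
qed

lemma fps_value_const_mult:
  fixes F :: "'a::{ultrametric_field, complete_space} fps"
  assumes "fps_converges_at F x"
  shows "fps_converges_at (fps_const c * F) x" "fps_value (fps_const c * F) x = c * fps_value F x"
  using has_sum_cmult_right[OF fps_value_has_sum[OF assms], of c]
  by (auto intro!: fps_value_unique simp: mult.assoc)

lemma fps_value_1: "fps_converges_at 1 x" "fps_value 1 x = 1"
proof -
  have "((\<lambda>n. (1::'a fps) $ n * x ^ n) has_sum 1) UNIV"
    by (rule has_sum_finite_neutralI[of "{0}"]) auto
  from fps_value_unique[OF this] show "fps_converges_at 1 x" "fps_value 1 x = 1"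
    by auto
qed

text \<open>
  The Cauchy product arranges the terms \<open>F $ i * x ^ i * (G $ m * x ^ m)\<close> by the total degree
  \<open>k = i + m\<close>.  As a double family in \<open>i\<close> and \<open>k\<close>, its rows sum to multiples of the value of \<open>G\<close>, and its
  columns are the terms of the product series.
\<close>

lemma fps_value_mult:
  fixes F G :: "'a::{ultrametric_field, complete_space} fps"
  assumes "fps_converges_at F x" "fps_converges_at G x"
  shows "fps_converges_at (F * G) x" "fps_value (F * G) x = fps_value F x * fps_value G x"
proof -
  let ?a = "\<lambda>i k. if i \<le> k then F $ i * G $ (k - i) * x ^ k else 0"
  obtain S where S: "((\<lambda>i. F $ i * x ^ i * fps_value G x) has_sum S) UNIV"
    "((\<lambda>k. (F * G) $ k * x ^ k) has_sum S) UNIV"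
  proof (rule has_sum_exchange[where a = ?a])
    fix e :: real assume "e > 0"
    obtain M where M: "0 < M" "\<And>n. absval (F $ n) * absval x ^ n \<le> M"
      using fps_terms_bounded[OF assms(1)] by blast
    obtain M' where M': "0 < M'" "\<And>n. absval (G $ n) * absval x ^ n \<le> M'"
      using fps_terms_bounded[OF assms(2)] by blast
    define A where "A = {n. e / M' \<le> absval (F $ n) * absval x ^ n}"
    define B where "B = {n. e / M \<le> absval (G $ n) * absval x ^ n}"
    have "finite A" "finite B"
      unfolding A_def B_def using assms \<open>e > 0\<close> M(1) M'(1)
      by (auto simp: fps_converges_at_iff intro!: finite_superlevel_if_tendsto_0)
    \<comment> \<open>A product of two bounded factors is large only if each factor is.\<close>
    have "{(i, k). e \<le> absval (?a i k)} \<subseteq> (\<lambda>(i, m). (i, i + m)) ` (A \<times> B)"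
    proof clarify
      fix i k assume le: "e \<le> absval (?a i k)"
      with \<open>e > 0\<close> have "i \<le> k"
        by (auto split: if_splits)
      then obtain m where k: "k = i + m"
        using le_Suc_ex by blast
      let ?u = "absval (F $ i) * absval x ^ i" and ?v = "absval (G $ m) * absval x ^ m"
      have "e \<le> ?u * ?v"
        using le k by (simp add: absval_mult absval_power power_add mult_ac)
      moreover have "?u * ?v \<le> ?u * M'" "?u * ?v \<le> M * ?v"
        using M(2) M'(2) by (auto intro!: mult_left_mono mult_right_mono simp: absval_nonneg)
      ultimately have "i \<in> A" "m \<in> B"
        using M(1) M'(1) by (auto simp: A_def B_def field_simps)
      then show "(i, k) \<in> (\<lambda>(i, m). (i, i + m)) ` (A \<times> B)"
        using k by auto
    qed
    then show "finite {(i, k). e \<le> absval (?a i k)}"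
      using \<open>finite A\<close> \<open>finite B\<close> finite_subset by blast
  next
    fix i
    have "((\<lambda>m. F $ i * x ^ i * (G $ m * x ^ m)) has_sum F $ i * x ^ i * fps_value G x) UNIV"
      by (intro has_sum_cmult_right fps_value_has_sum assms)
    then have "((\<lambda>m. ?a i (i + m)) has_sum F $ i * x ^ i * fps_value G x) UNIV"
      by (simp add: power_add mult_ac)
    moreover have "bij_betw ((+) i) UNIV {i..}"
      by (rule bij_betwI[of _ _ _ "\<lambda>k. k - i"]) auto
    ultimately have "(?a i has_sum F $ i * x ^ i * fps_value G x) {i..}"
      by (subst (asm) has_sum_reindex_bij_betw[where f = "?a i"])
    then show "(?a i has_sum F $ i * x ^ i * fps_value G x) UNIV"
      by (rule has_sum_cong_neutral[THEN iffD1, rotated -1]) auto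
  next
    fix k
    show "((\<lambda>i. ?a i k) has_sum (F * G) $ k * x ^ k) UNIV"
      by (rule has_sum_finite_neutralI[of "{0..k}"]) (auto simp: fps_mult_nth sum_distrib_right)
  qed
  moreover have "((\<lambda>i. F $ i * x ^ i * fps_value G x) has_sum fps_value F x * fps_value G x) UNIV"
    by (intro has_sum_cmult_left fps_value_has_sum assms)
  ultimately have "S = fps_value F x * fps_value G x"
    using has_sum_unique by blast
  then show "fps_converges_at (F * G) x" "fps_value (F * G) x = fps_value F x * fps_value G x"
    using fps_value_unique[OF S(2)] by simp_all
qed

lemma fps_value_power:
  fixes F :: "'a::{ultrametric_field, complete_space} fps"
  assumes "fps_converges_at F x"
  shows "fps_converges_at (F ^ n) x \<and> fps_value (F ^ n) x = fps_value F x ^ n"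
  by (induction n) (use assms in \<open>auto simp: fps_value_1 fps_value_mult\<close>)

text \<open>
  The least upper bound of \<open>absval (F $ i) * r ^ i\<close> over all \<open>i\<close> is the Gauss norm of \<open>F\<close> at radius \<open>r\<close>; it is
  submultiplicative because the ultrametric inequality bounds a sum by its largest term.  Stating
  it with an arbitrary bound covers series of infinite norm as well.
\<close>

lemma absval_fps_mult_nth_le:
  fixes F G :: "'a::ultrametric_field fps"
  assumes "0 \<le> r" "\<And>i. absval (F $ i) * r ^ i \<le> A" "\<And>i. absval (G $ i) * r ^ i \<le> B"
  shows "absval ((F * G) $ k) * r ^ k \<le> A * B"
proof -
  have nonneg: "0 \<le> A" "0 \<le> B"
    using assms(2,3)[of 0] absval_nonneg[of "F $ 0"] absval_nonneg[of "G $ 0"] by simp_all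
  show ?thesis
  proof (cases "r ^ k = 0")
    case False
    then have pos: "0 < r ^ k"
      using zero_le_power[OF assms(1), of k] by linarith
    have "absval ((F * G) $ k) \<le> A * B / r ^ k"
      unfolding fps_mult_nth
    proof (rule absval_sum_le)
      fix i assume "i \<in> {0..k}"
      then have "r ^ k = r ^ i * r ^ (k - i)"
        by (simp flip: power_add)
      then have "absval (F $ i * G $ (k - i)) * r ^ k
          = (absval (F $ i) * r ^ i) * (absval (G $ (k - i)) * r ^ (k - i))"
        by (simp add: absval_mult mult_ac)
      also have "\<dots> \<le> A * B"
        using assms nonneg by (intro mult_mono) (auto simp: absval_nonneg)
      finally show "absval (F $ i * G $ (k - i)) \<le> A * B / r ^ k"
        using pos by (simp add: field_simps)
    qed (use nonneg pos in simp)
    then show ?thesis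
      using pos by (simp add: field_simps)
  qed (use nonneg in \<open>simp del: power_eq_0_iff\<close>)
qed

lemma absval_fps_power_nth_le:
  fixes F :: "'a::ultrametric_field fps"
  assumes "0 \<le> r" "\<And>i. absval (F $ i) * r ^ i \<le> A"
  shows "absval ((F ^ n) $ k) * r ^ k \<le> A ^ n"
proof (induction n arbitrary: k)
  case (Suc n)
  show ?case
    using absval_fps_mult_nth_le[OF assms Suc] by simp
qed auto

text \<open>
  Here \<open>r\<close> bounds the Gauss norm of \<open>F\<close> at radius \<open>absval x\<close>, so all terms of \<open>G $ n * F ^ n\<close> at \<open>x\<close> have size
  at most \<open>absval (G $ n) * r ^ n\<close>.  As this tends to \<open>0\<close>, the sums over \<open>n\<close> and over the degree can be
  exchanged.  It is not enough that \<open>G\<close> converges at the value of \<open>F\<close>, because \<open>F\<close> may be small at \<open>x\<close>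
  by cancellation among large terms.
\<close>

lemma fps_value_compose:
  fixes F G :: "'a::{ultrametric_field, complete_space} fps"
  assumes F: "F $ 0 = 0" "fps_converges_at F x"
    and bound: "\<And>i. absval (F $ i) * absval x ^ i \<le> r"
    and G: "(\<lambda>n. absval (G $ n) * r ^ n) \<longlonglongrightarrow> 0"
  shows "fps_converges_at (G oo F) x" "fps_value (G oo F) x = fps_value G (fps_value F x)"
proof -
  let ?a = "\<lambda>n k. G $ n * ((F ^ n) $ k * x ^ k)"
  obtain S where S: "((\<lambda>n. G $ n * fps_value F x ^ n) has_sum S) UNIV"
    "((\<lambda>k. (G oo F) $ k * x ^ k) has_sum S) UNIV"
  proof (rule has_sum_exchange[where a = ?a])
    fix e :: real assume "e > 0"
    have "absval (?a n k) \<le> absval (G $ n) * r ^ n" for n k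
      using absval_fps_power_nth_le[OF absval_nonneg bound, of n k]
      by (auto simp: absval_mult absval_power intro!: mult_left_mono absval_nonneg)
    then have "{(n, k). e \<le> absval (?a n k)}
      \<subseteq> Sigma {n. e \<le> absval (G $ n) * r ^ n} (\<lambda>n. {k. e \<le> absval (?a n k)})"
      using order_trans by blast
    moreover have "finite {n. e \<le> absval (G $ n) * r ^ n}"
      using G \<open>e > 0\<close> by (rule finite_superlevel_if_tendsto_0)
    moreover have "finite {k. e \<le> absval (?a n k)}" for n
    proof (rule finite_superlevel_if_tendsto_0[OF _ \<open>e > 0\<close>])
      have "(\<lambda>k. absval ((F ^ n) $ k) * absval x ^ k) \<longlonglongrightarrow> 0"
        using fps_value_power[OF F(2)] by (simp flip: fps_converges_at_iff)
      from tendsto_mult_right_zero[OF this, of "absval (G $ n)"]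
      show "(\<lambda>k. absval (?a n k)) \<longlonglongrightarrow> 0"
        by (simp add: absval_mult absval_power)
    qed
    ultimately show "finite {(n, k). e \<le> absval (?a n k)}"
      by (rule finite_subset[OF _ finite_SigmaI])
  next
    fix n
    show "(?a n has_sum G $ n * fps_value F x ^ n) UNIV"
      using fps_value_has_sum[of "F ^ n" x] fps_value_power[OF F(2), of n]
      by (intro has_sum_cmult_right) simp
  next
    fix k
    show "((\<lambda>n. ?a n k) has_sum (G oo F) $ k * x ^ k) UNIV"
      by (rule has_sum_finite_neutralI[of "{0..k}"])
        (auto simp: startsby_zero_power_prefix[OF F(1)] fps_compose_nth sum_distrib_right mult.assoc)
  qed
  show "fps_converges_at (G oo F) x" "fps_value (G oo F) x = fps_value G (fps_value F x)"
    using fps_value_unique[OF S(1)] fps_value_unique[OF S(2)] by simp_all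
qed

section \<open>Power series near the origin\<close>

lemma fps_value_shift:
  fixes F :: "'a::{ultrametric_field, complete_space} fps"
  assumes "fps_converges_at F x" "x \<noteq> 0"
  shows "fps_converges_at (fps_shift 1 F) x"
    "fps_value F x = F $ 0 + x * fps_value (fps_shift 1 F) x"
proof -
  have "(\<lambda>n. absval (F $ Suc n) * absval x ^ Suc n / absval x) \<longlonglongrightarrow> 0 / absval x"
    using assms unfolding fps_converges_at_iff
    by (intro tendsto_divide tendsto_const LIMSEQ_Suc) (auto simp: absval_eq_0)
  then show conv: "fps_converges_at (fps_shift 1 F) x"
    using assms(2) by (simp add: fps_converges_at_iff absval_eq_0)
  have "(\<lambda>n. F $ 0 + x * (\<Sum>i<n. fps_shift 1 F $ i * x ^ i)) \<longlonglongrightarrow>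
      F $ 0 + x * fps_value (fps_shift 1 F) x"
    using fps_value_sums[OF conv] unfolding sums_def by (intro tendsto_intros)
  moreover have "F $ 0 + x * (\<Sum>i<n. fps_shift 1 F $ i * x ^ i) = (\<Sum>i<Suc n. F $ i * x ^ i)" for n
    by (subst sum.lessThan_Suc_shift) (simp add: sum_distrib_left mult_ac)
  ultimately have "(\<lambda>n. \<Sum>i<Suc n. F $ i * x ^ i) \<longlonglongrightarrow> F $ 0 + x * fps_value (fps_shift 1 F) x"
    by simp
  moreover have "(\<lambda>n. \<Sum>i<Suc n. F $ i * x ^ i) \<longlonglongrightarrow> fps_value F x"
    using fps_value_sums[OF assms(1)] unfolding sums_def by (rule LIMSEQ_Suc)
  ultimately show "fps_value F x = F $ 0 + x * fps_value (fps_shift 1 F) x"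
    using LIMSEQ_unique by blast
qed

lemma fps_converges_at_mono:
  fixes F :: "'a::{ultrametric_field, complete_space} fps"
  assumes "fps_converges_at F y" "absval x \<le> absval y"
  shows "fps_converges_at F x"
  using assms(1)[unfolded fps_converges_at_iff]
proof (rule fps_converges_at_if_le)
  show "absval (F $ n) * absval x ^ n \<le> absval (F $ n) * absval y ^ n" for n
    by (intro mult_left_mono power_mono assms(2) absval_nonneg)
qed

text \<open>
  The remainder \<open>F x - F $ 0\<close> is \<open>x\<close> times the value of the shifted series, which is bounded near the
  origin.
\<close>

lemma fps_value_tendsto_at_0:
  fixes F :: "'a::{ultrametric_field, complete_space} fps"
  assumes F: "fps_converges_at F y" and y: "y \<noteq> 0"
  shows "(fps_value F \<longlongrightarrow> F $ 0) (at 0)"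
proof -
  let ?H = "fps_shift 1 F"
  have H: "fps_converges_at ?H y"
    using F y by (rule fps_value_shift)
  obtain M where M: "0 < M" "\<And>n. absval (?H $ n) * absval y ^ n \<le> M"
    using fps_terms_bounded[OF H] by blast
  have le: "absval (fps_value F x - F $ 0) \<le> absval x * M"
    if x: "x \<noteq> 0" "absval x \<le> absval y" for x
  proof -
    have "absval (?H $ n) * absval x ^ n \<le> absval (?H $ n) * absval y ^ n" for n
      using x by (intro mult_left_mono power_mono absval_nonneg) auto
    then have "absval (fps_value ?H x) \<le> M"
      using M(2) by (intro absval_fps_value_le fps_converges_at_mono[OF H x(2)]) (rule order_trans)
    moreover have "fps_value F x - F $ 0 = x * fps_value ?H x"
      using fps_value_shift(2)[OF fps_converges_at_mono[OF F x(2)] x(1)] by simp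
    ultimately show ?thesis
      by (simp add: absval_mult absval_nonneg mult_left_mono)
  qed
  have "\<forall>\<^sub>F x in at 0. x \<noteq> 0 \<and> absval x \<le> absval y"
    unfolding eventually_at using y absval_nonneg[of y]
    by (intro exI[of _ "absval y"]) (auto simp: absval_eq_dist dist_commute less_le)
  then have upper: "\<forall>\<^sub>F x in at 0. absval (fps_value F x - F $ 0) \<le> absval x * M"
    by (rule eventually_mono) (simp add: le)
  have lim: "((\<lambda>x. absval x * M) \<longlongrightarrow> 0) (at (0::'a))"
    using tendsto_mult_left_zero[of "absval" "at (0::'a)" M]
      tendsto_absval[OF tendsto_ident_at[of "0::'a" UNIV]] by simp
  have "((\<lambda>x. absval (fps_value F x - F $ 0)) \<longlongrightarrow> 0) (at 0)"
    by (rule tendsto_sandwich[OF _ upper tendsto_const lim]) (simp add: absval_nonneg)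
  then show ?thesis
    by (rule tendsto_absval_diff_0_iff[THEN iffD2])
qed

lemma ex_nonzero_absval_less:
  assumes "at (0::'a::ultrametric_field) \<noteq> bot" "0 < r"
  shows "\<exists>y::'a. y \<noteq> 0 \<and> absval y < r"
proof -
  have "(0::'a) islimpt UNIV"
    using assms(1) by (simp add: trivial_limit_within)
  then show ?thesis
    using assms(2) unfolding islimpt_approachable by (auto simp: absval_eq_dist)
qed

text \<open>
  The hypothesis leaves out the origin so that it passes from \<open>F\<close> to the shifted series, whose value is
  obtained by dividing by \<open>x\<close>; this drives the induction on the index of the coefficient.
\<close>

lemma fps_eq_0_if_value_eq_0:
  fixes F :: "'a::{ultrametric_field, complete_space} fps"
  assumes nontrivial: "at (0::'a) \<noteq> bot" and "0 < \<rho>"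
    and "\<And>x. x \<noteq> 0 \<Longrightarrow> absval x < \<rho> \<Longrightarrow> fps_converges_at F x \<and> fps_value F x = 0"
  shows "F = 0"
proof -
  have constant_term: "F $ 0 = 0"
    if F: "\<And>x. x \<noteq> 0 \<Longrightarrow> absval x < \<rho> \<Longrightarrow> fps_converges_at F x \<and> fps_value F x = 0"
    for F :: "'a fps"
  proof -
    obtain y :: 'a where y: "y \<noteq> 0" "absval y < \<rho>"
      using ex_nonzero_absval_less[OF assms(1,2)] by blast
    then have lim: "(fps_value F \<longlongrightarrow> F $ 0) (at 0)"
      using F by (intro fps_value_tendsto_at_0[of F y]) auto
    have "\<forall>\<^sub>F x in at 0. fps_value F x = 0"
      unfolding eventually_at using assms(2) F
      by (intro exI[of _ \<rho>]) (auto simp: absval_eq_dist)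
    then have "(fps_value F \<longlongrightarrow> 0) (at 0)"
      by (rule tendsto_eventually)
    then show ?thesis
      using tendsto_unique[OF nontrivial lim] by simp
  qed
  have "F $ n = 0" for n
    using assms(3)
  proof (induction n arbitrary: F)
    case (0 F)
    then show ?case
      by (rule constant_term)
  next
    case (Suc n F)
    have "fps_shift 1 F $ n = 0"
    proof (rule Suc.IH)
      fix x :: 'a assume x: "x \<noteq> 0" "absval x < \<rho>"
      then show "fps_converges_at (fps_shift 1 F) x \<and> fps_value (fps_shift 1 F) x = 0"
        using fps_value_shift[of F x] Suc.prems[OF x] constant_term[OF Suc.prems] by simp
    qed
    then show ?case
      by simp
  qed
  then show ?thesis
    by (simp add: fps_eq_iff)
qed

lemma fps_represents_unique:
  fixes F G :: "'a::{ultrametric_field, complete_space} fps"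
  assumes "at (0::'a) \<noteq> bot" "0 < \<rho>" "fps_represents F g \<rho>" "fps_represents G g \<rho>"
  shows "F = G"
proof -
  have "F - G = 0"
    using assms(3,4) unfolding fps_represents_def open_disc_def
    by (intro fps_eq_0_if_value_eq_0[OF assms(1,2)]) (auto simp: fps_value_diff)
  then show ?thesis
    by simp
qed

lemma fps_represents_difference_quotient_tendsto:
  fixes G :: "'a::{ultrametric_field, complete_space} fps"
  assumes nontrivial: "at (0::'a) \<noteq> bot" and "0 < \<rho>" and G: "fps_represents G g \<rho>"
  shows "((\<lambda>x. (g x - g 0) / (x - 0)) \<longlongrightarrow> G $ 1) (at 0)"
proof -
  have conv: "fps_converges_at G x" and val: "g x = fps_value G x" if "absval x < \<rho>" for x
    using G that by (auto simp: fps_represents_def open_disc_def)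
  obtain y :: 'a where y: "y \<noteq> 0" "absval y < \<rho>"
    using ex_nonzero_absval_less[OF nontrivial \<open>0 < \<rho>\<close>] by blast
  have "(fps_value (fps_shift 1 G) \<longlongrightarrow> fps_shift 1 G $ 0) (at 0)"
    using fps_value_shift(1)[OF conv[OF y(2)] y(1)] y(1) by (rule fps_value_tendsto_at_0)
  moreover have "\<forall>\<^sub>F x in at 0. fps_value (fps_shift 1 G) x = (g x - g 0) / (x - 0)"
    unfolding eventually_at using \<open>0 < \<rho>\<close>
  proof (intro exI[of _ \<rho>] conjI ballI impI)
    fix x :: 'a assume "x \<noteq> 0 \<and> dist x 0 < \<rho>"
    then have x: "x \<noteq> 0" "absval x < \<rho>"
      by (auto simp: absval_eq_dist)
    then show "fps_value (fps_shift 1 G) x = (g x - g 0) / (x - 0)"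
      using fps_value_shift(2)[OF conv[OF x(2)] x(1)] val[OF x(2)] val[of 0] \<open>0 < \<rho>\<close>
      by (simp add: fps_value_0)
  qed
  ultimately show ?thesis
    by (simp add: tendsto_cong)
qed

section \<open>The functional equation for formal power series\<close>

definition satisfies_schroeder :: "'a::field fps \<Rightarrow> 'a \<Rightarrow> 'a fps \<Rightarrow> bool" where
  "satisfies_schroeder f l G \<longleftrightarrow> G $ 0 = 0 \<and> G $ 1 = 1 \<and> G oo f = fps_const l * G"

text \<open>
  The coefficient of \<open>f ^ k\<close> in degree \<open>k\<close> is \<open>l ^ k\<close>, and \<open>f ^ j\<close> has no term of degree \<open>k < j\<close>.
\<close>

lemma schroeder_recurrence:
  fixes f G :: "'a::field fps"
  assumes "f $ 0 = 0" "f $ 1 = l"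
  shows "G oo f = fps_const l * G \<longleftrightarrow>
    (\<forall>k. (l - l ^ k) * G $ k = (\<Sum>j<k. G $ j * (f ^ j) $ k))"
proof -
  have nth: "(G oo f) $ k = (\<Sum>j<k. G $ j * (f ^ j) $ k) + G $ k * l ^ k" for k
    using assms startsby_zero_power_nth_same[of f k]
    by (simp add: fps_compose_nth atLeast0AtMost lessThan_Suc_atMost[symmetric])
  have "(G oo f) $ k = (fps_const l * G) $ k
      \<longleftrightarrow> (l - l ^ k) * G $ k = (\<Sum>j<k. G $ j * (f ^ j) $ k)" for k
    unfolding nth fps_mult_left_const_nth by (auto simp: algebra_simps)
  then show ?thesis
    by (simp add: fps_eq_iff)
qed

fun schroeder_coeff :: "'a::field fps \<Rightarrow> 'a \<Rightarrow> nat \<Rightarrow> 'a" where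
  "schroeder_coeff f l k =
    (if k = 0 then 0 else if k = 1 then 1
     else (\<Sum>j<k. schroeder_coeff f l j * (f ^ j) $ k) / (l - l ^ k))"

declare schroeder_coeff.simps [simp del]

lemma satisfies_schroeder_Abs_fps:
  fixes f :: "'a::field fps"
  assumes f: "f $ 0 = 0" "f $ 1 = l" and l: "\<And>k. 2 \<le> k \<Longrightarrow> l ^ k \<noteq> l"
  shows "satisfies_schroeder f l (Abs_fps (schroeder_coeff f l))"
proof -
  have "(l - l ^ k) * schroeder_coeff f l k = (\<Sum>j<k. schroeder_coeff f l j * (f ^ j) $ k)" for k
  proof -
    consider "k = 0" | "k = 1" | "2 \<le> k"
      by linarith
    then show ?thesis
    proof cases
      case 3
      then show ?thesis
        using l[of k] by (subst schroeder_coeff.simps) simp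
    qed (simp_all add: schroeder_coeff.simps)
  qed
  then show ?thesis
    unfolding satisfies_schroeder_def schroeder_recurrence[OF f]
    by (simp add: schroeder_coeff.simps)
qed

lemma satisfies_schroeder_unique:
  fixes f :: "'a::field fps"
  assumes f: "f $ 0 = 0" "f $ 1 = l" and l: "\<And>k. 2 \<le> k \<Longrightarrow> l ^ k \<noteq> l"
    and G: "satisfies_schroeder f l G" and H: "satisfies_schroeder f l H"
  shows "G = H"
proof -
  have "G $ k = H $ k" for k
  proof (induction k rule: less_induct)
    case (less k)
    consider "k = 0" | "k = 1" | "2 \<le> k"
      by linarith
    then show ?case
    proof cases
      case 3
      have "(l - l ^ k) * G $ k = (\<Sum>j<k. G $ j * (f ^ j) $ k)"
        "(l - l ^ k) * H $ k = (\<Sum>j<k. H $ j * (f ^ j) $ k)"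
        using G H unfolding satisfies_schroeder_def schroeder_recurrence[OF f] by auto
      then have "(l - l ^ k) * G $ k = (l - l ^ k) * H $ k"
        using less by simp
      then show ?thesis
        using l[OF 3] by simp
    qed (use G H in \<open>simp_all add: satisfies_schroeder_def\<close>)
  qed
  then show ?thesis
    by (simp add: fps_eq_iff)
qed

section \<open>Growth of the coefficients\<close>

lemma absval_le_absval_diff_power:
  fixes l :: "'a::ultrametric_field"
  assumes "0 < absval l" "absval l < 1" "2 \<le> k"
  shows "absval l \<le> absval (l - l ^ k)"
proof -
  have "absval l ^ k < absval l ^ 1"
    using assms by (intro power_strict_decreasing) auto
  then show ?thesis
    using absval_add_le_max[of "l - l ^ k" "l ^ k"] by (simp add: absval_power)
qed

lemma power_neq_self:
  fixes l :: "'a::ultrametric_field"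
  assumes "0 < absval l" "absval l < 1" "2 \<le> k"
  shows "l ^ k \<noteq> l"
  using absval_le_absval_diff_power[OF assms] assms(1) by auto

text \<open>
  One step of the recurrence.  Dividing by \<open>l - l ^ k\<close> costs a factor \<open>1 / absval l\<close>, which the bound on
  the terms has to provide.
\<close>

lemma schroeder_nth_le:
  fixes f G :: "'a::ultrametric_field fps"
  assumes l: "0 < absval l" "absval l < 1"
    and f: "f $ 0 = 0" "f $ 1 = l" and G: "satisfies_schroeder f l G"
    and "2 \<le> k" "0 < r"
    and terms: "\<And>j. 1 \<le> j \<Longrightarrow> j < k \<Longrightarrow> absval (G $ j) * (absval ((f ^ j) $ k) * r ^ k) \<le> absval l * B"
    and "0 \<le> B"
  shows "absval (G $ k) * r ^ k \<le> B"
proof -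
  have "(l - l ^ k) * G $ k = (\<Sum>j<k. G $ j * (f ^ j) $ k)"
    using G unfolding satisfies_schroeder_def schroeder_recurrence[OF f] by auto
  moreover have "absval (\<Sum>j<k. G $ j * (f ^ j) $ k) \<le> absval l * B / r ^ k"
  proof (rule absval_sum_le)
    fix j assume j: "j \<in> {..<k}"
    show "absval (G $ j * (f ^ j) $ k) \<le> absval l * B / r ^ k"
    proof (cases "j = 0")
      case True
      then show ?thesis
        using G assms by (simp add: satisfies_schroeder_def)
    next
      case False
      then show ?thesis
        using terms[of j] j \<open>0 < r\<close> by (simp add: absval_mult field_simps)
    qed
  qed (use l \<open>0 < r\<close> \<open>0 \<le> B\<close> in simp)
  ultimately have "absval (l - l ^ k) * absval (G $ k) \<le> absval l * B / r ^ k"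
    by (metis absval_mult)
  moreover have "absval l * absval (G $ k) \<le> absval (l - l ^ k) * absval (G $ k)"
    using absval_le_absval_diff_power[OF l \<open>2 \<le> k\<close>] by (intro mult_right_mono absval_nonneg)
  ultimately have "absval l * absval (G $ k) \<le> absval l * B / r ^ k"
    by (rule order_trans[rotated])
  then have "absval l * (absval (G $ k) * r ^ k) \<le> absval l * B"
    using \<open>0 < r\<close> by (simp add: field_simps)
  then show ?thesis
    using l(1) by simp
qed

lemma family_nth_le:
  assumes "f \<in> power_series_family l \<rho>" "0 < \<rho>" "absval l < 1"
  shows "absval (f $ i) * \<rho> ^ i \<le> \<rho>"
proof -
  consider "i = 0" | "i = 1" | "2 \<le> i"
    by linarith
  then show ?thesis
  proof cases
    case 3
    let ?S = "SUP i\<in>{2..}. ereal (root (i - 1) (absval (f $ i)))"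
    have "1 / ?S = ereal \<rho>"
      using assms(1) by (simp add: power_series_family_def)
    then have S: "?S = ereal (1 / \<rho>)"
      using assms(2) by (cases ?S) (auto simp: divide_ereal_def field_simps split: if_splits)
    have "ereal (root (i - 1) (absval (f $ i))) \<le> ?S"
      using 3 by (intro SUP_upper) simp
    then have "root (i - 1) (absval (f $ i)) \<le> 1 / \<rho>"
      unfolding S by simp
    then have "root (i - 1) (absval (f $ i)) ^ (i - 1) \<le> (1 / \<rho>) ^ (i - 1)"
      by (intro power_mono real_root_ge_zero absval_nonneg)
    then have "absval (f $ i) \<le> (1 / \<rho>) ^ (i - 1)"
      using 3 by (simp add: absval_nonneg)
    moreover have "\<rho> ^ i = \<rho> * \<rho> ^ (i - 1)"
      using 3 by (simp flip: power_Suc)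
    ultimately show ?thesis
      using assms(2) by (simp add: power_divide field_simps)
  qed (use assms in \<open>auto simp: power_series_family_def\<close>)
qed

text \<open>
  Shrinking the radius by the factor \<open>absval l\<close> makes the linear term, of size
  \<open>absval l * (absval l * \<rho>)\<close>, as small as the bound for the terms of higher degree.
\<close>

lemma nth_le_scaled_radius:
  assumes "f $ 0 = 0" "f $ 1 = l" "\<And>i. absval (f $ i) * \<rho> ^ i \<le> \<rho>"
    and l: "0 < absval l" "absval l < 1" and "0 < \<rho>"
  shows "absval (f $ i) * (absval l * \<rho>) ^ i \<le> absval l ^ 2 * \<rho>"
proof -
  consider "i = 0" | "i = 1" | "2 \<le> i"
    by linarith
  then show ?thesis
  proof cases
    case 3
    have "absval (f $ i) * (absval l * \<rho>) ^ i = absval l ^ i * (absval (f $ i) * \<rho> ^ i)"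
      by (simp add: power_mult_distrib)
    also have "\<dots> \<le> absval l ^ 2 * \<rho>"
      using assms 3 by (intro mult_mono power_decreasing) (auto simp: absval_nonneg)
    finally show ?thesis .
  qed (use assms in \<open>auto simp: power2_eq_square absval_nonneg\<close>)
qed

text \<open>
  At radius \<open>absval l * \<rho>\<close>, the term of index \<open>j\<close> in the recurrence is by \<open>nth_le_scaled_radius\<close> smaller
  by a factor \<open>absval l ^ j\<close> than the bound for \<open>G $ j\<close>.  As \<open>j \<ge> 1\<close>, this absorbs the division.
\<close>

lemma schroeder_nth_le_scaled_radius:
  fixes f G :: "'a::ultrametric_field fps"
  assumes l: "0 < absval l" "absval l < 1" and "0 < \<rho>"
    and f: "f $ 0 = 0" "f $ 1 = l" "\<And>i. absval (f $ i) * \<rho> ^ i \<le> \<rho>"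
    and G: "satisfies_schroeder f l G"
  shows "absval (G $ k) * (absval l * \<rho>) ^ k \<le> absval l * \<rho>"
proof (induction k rule: less_induct)
  case (less k)
  let ?c = "absval l"
  consider "k = 0" | "k = 1" | "2 \<le> k"
    by linarith
  then show ?case
  proof cases
    case 3
    show ?thesis
    proof (rule schroeder_nth_le[OF l f(1,2) G 3])
      fix j assume j: "1 \<le> j" "j < k"
      have "absval ((f ^ j) $ k) * (?c * \<rho>) ^ k \<le> (?c ^ 2 * \<rho>) ^ j"
        using nth_le_scaled_radius[OF f l \<open>0 < \<rho>\<close>] l \<open>0 < \<rho>\<close> by (intro absval_fps_power_nth_le) auto
      then have "absval (G $ j) * (absval ((f ^ j) $ k) * (?c * \<rho>) ^ k)
          \<le> absval (G $ j) * (?c ^ 2 * \<rho>) ^ j"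
        by (intro mult_left_mono absval_nonneg)
      also have "\<dots> = ?c ^ j * (absval (G $ j) * (?c * \<rho>) ^ j)"
        by (simp add: power_mult_distrib power2_eq_square)
      also have "\<dots> \<le> ?c ^ 1 * (?c * \<rho>)"
        using j l \<open>0 < \<rho>\<close> by (intro mult_mono[OF power_decreasing less]) (auto simp: absval_nonneg)
      finally show "absval (G $ j) * (absval ((f ^ j) $ k) * (?c * \<rho>) ^ k) \<le> ?c * (?c * \<rho>)"
        by simp
    qed (use l \<open>0 < \<rho>\<close> in auto)
  qed (use G l \<open>0 < \<rho>\<close> in \<open>auto simp: satisfies_schroeder_def\<close>)
qed

text \<open>
  The exponent \<open>N\<close> is chosen so that doubling the index gains at least the factor \<open>1 / absval l\<close>.
  Terms with \<open>2 * j \<le> k\<close> are then small enough because \<open>j ^ N\<close> is much smaller than \<open>k ^ N\<close>; for the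
  others, \<open>f ^ j\<close> itself contributes a factor \<open>absval l\<close>, since a product of \<open>j\<close> terms of \<open>f\<close> that has total
  degree \<open>k < 2 * j\<close> must contain a linear one.
\<close>

lemma schroeder_nth_le_polynomial:
  fixes f G :: "'a::ultrametric_field fps"
  assumes l: "0 < absval l" "absval l < 1" and "0 < \<rho>"
    and f: "f $ 0 = 0" "f $ 1 = l" "\<And>i. absval (f $ i) * \<rho> ^ i \<le> \<rho>"
    and G: "satisfies_schroeder f l G"
    and N: "1 \<le> absval l * 2 ^ N"
  shows "absval (G $ k) * \<rho> ^ k \<le> real k ^ N * \<rho>"
proof (induction k rule: less_induct)
  case (less k)
  let ?c = "absval l"
  consider "k = 0" | "k = 1" | "2 \<le> k"
    by linarith
  then show ?case
  proof cases
    case 3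
    show ?thesis
    proof (rule schroeder_nth_le[OF l f(1,2) G 3 \<open>0 < \<rho>\<close>])
      fix j assume j: "1 \<le> j" "j < k"
      have IH: "absval (G $ j) * \<rho> ^ j \<le> real j ^ N * \<rho>"
        by (rule less[OF j(2)])
      show "absval (G $ j) * (absval ((f ^ j) $ k) * \<rho> ^ k) \<le> ?c * (real k ^ N * \<rho>)"
      proof (cases "2 * j \<le> k")
        case True
        have "absval ((f ^ j) $ k) * \<rho> ^ k \<le> \<rho> ^ j"
          using f(3) \<open>0 < \<rho>\<close> by (intro absval_fps_power_nth_le) auto
        then have "absval (G $ j) * (absval ((f ^ j) $ k) * \<rho> ^ k) \<le> absval (G $ j) * \<rho> ^ j"
          by (intro mult_left_mono absval_nonneg)
        also have "\<dots> \<le> (?c * 2 ^ N) * (real j ^ N * \<rho>)"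
          using IH mult_right_mono[OF N, of "real j ^ N * \<rho>"] \<open>0 < \<rho>\<close> by simp
        also have "\<dots> = ?c * (real (2 * j) ^ N * \<rho>)"
          by (simp add: power_mult_distrib)
        also have "\<dots> \<le> ?c * (real k ^ N * \<rho>)"
          using True l \<open>0 < \<rho>\<close> by (intro mult_left_mono mult_right_mono power_mono) auto
        finally show ?thesis .
      next
        case False
        have "absval ((f ^ j) $ k) * (?c * \<rho>) ^ k \<le> (?c ^ 2 * \<rho>) ^ j"
          using nth_le_scaled_radius[OF f l \<open>0 < \<rho>\<close>] l \<open>0 < \<rho>\<close> by (intro absval_fps_power_nth_le) auto
        also have "(?c ^ 2 * \<rho>) ^ j = ?c ^ k * (?c ^ (2 * j - k) * \<rho> ^ j)"
          using False by (simp add: power_mult_distrib flip: power_mult power_add mult.assoc)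
        finally have "?c ^ k * (absval ((f ^ j) $ k) * \<rho> ^ k) \<le> ?c ^ k * (?c ^ (2 * j - k) * \<rho> ^ j)"
          by (simp add: power_mult_distrib mult_ac)
        then have "absval ((f ^ j) $ k) * \<rho> ^ k \<le> ?c ^ (2 * j - k) * \<rho> ^ j"
          using l(1) by simp
        also have "\<dots> \<le> ?c ^ 1 * \<rho> ^ j"
          using False l \<open>0 < \<rho>\<close> by (intro mult_right_mono power_decreasing) auto
        finally have "absval (G $ j) * (absval ((f ^ j) $ k) * \<rho> ^ k) \<le> absval (G $ j) * (?c * \<rho> ^ j)"
          by (intro mult_left_mono absval_nonneg) simp
        also have "\<dots> = ?c * (absval (G $ j) * \<rho> ^ j)"
          by simp
        also have "\<dots> \<le> ?c * (real j ^ N * \<rho>)"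
          using IH l by (intro mult_left_mono) auto
        also have "\<dots> \<le> ?c * (real k ^ N * \<rho>)"
          using j l \<open>0 < \<rho>\<close> by (intro mult_left_mono mult_right_mono power_mono) auto
        finally show ?thesis .
      qed
    qed (use \<open>0 < \<rho>\<close> in auto)
  qed (use G \<open>0 < \<rho>\<close> in \<open>auto simp: satisfies_schroeder_def\<close>)
qed

lemma polynomial_times_geometric_tendsto_0:
  fixes q :: real
  assumes "0 \<le> q" "q < 1"
  shows "(\<lambda>k. real k ^ N * q ^ k) \<longlonglongrightarrow> 0"
proof -
  \<comment> \<open>The sequence is dominated by the power \<open>Suc N\<close> of \<open>k * p ^ k\<close>, where \<open>p\<close> is a root of \<open>q\<close>; the
    exponent is positive even if \<open>N = 0\<close>.\<close>
  have "(\<lambda>k. real k * root (Suc N) q ^ k) \<longlonglongrightarrow> 0"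
    using assms by (intro powser_times_n_limit_0) simp
  from tendsto_power[OF this, of "Suc N"]
  have "(\<lambda>k. (real k * root (Suc N) q ^ k) ^ Suc N) \<longlonglongrightarrow> 0"
    by simp
  moreover have "(real k * root (Suc N) q ^ k) ^ Suc N = real k ^ Suc N * q ^ k" for k
  proof -
    have "(root (Suc N) q ^ k) ^ Suc N = (root (Suc N) q ^ Suc N) ^ k"
      by (simp only: mult.commute flip: power_mult)
    then show ?thesis
      using assms(1) by (simp only: power_mult_distrib real_root_pow_pos2 zero_less_Suc)
  qed
  ultimately have lim: "(\<lambda>k. real k ^ Suc N * q ^ k) \<longlonglongrightarrow> 0"
    by (simp only:)
  show ?thesis
  proof (rule tendsto_sandwich[OF _ _ tendsto_const lim])
    show "\<forall>\<^sub>F k in sequentially. real k ^ N * q ^ k \<le> real k ^ Suc N * q ^ k"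
      using assms(1)
      by (intro eventually_sequentiallyI[of 1] mult_right_mono power_increasing) auto
  qed (use assms(1) in auto)
qed

lemma schroeder_converges:
  fixes f G :: "'a::{ultrametric_field, complete_space} fps"
  assumes l: "0 < absval l" "absval l < 1" and "0 < \<rho>"
    and f: "f $ 0 = 0" "f $ 1 = l" "\<And>i. absval (f $ i) * \<rho> ^ i \<le> \<rho>"
    and G: "satisfies_schroeder f l G" and x: "absval x < \<rho>"
  shows "fps_converges_at G x"
proof -
  obtain N where "1 / absval l < 2 ^ N"
    using real_arch_pow[of 2 "1 / absval l"] by auto
  then have N: "1 \<le> absval l * 2 ^ N"
    using l(1) by (simp add: field_simps)
  let ?q = "absval x / \<rho>"
  have "(\<lambda>k. \<rho> * (real k ^ N * ?q ^ k)) \<longlonglongrightarrow> 0"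
    using x \<open>0 < \<rho>\<close>
    by (intro tendsto_mult_right_zero polynomial_times_geometric_tendsto_0) (auto simp: absval_nonneg)
  moreover have "absval (G $ k) * absval x ^ k \<le> \<rho> * (real k ^ N * ?q ^ k)" for k
  proof -
    have "absval (G $ k) * absval x ^ k = (absval (G $ k) * \<rho> ^ k) * ?q ^ k"
      using \<open>0 < \<rho>\<close> by (simp add: power_divide)
    also have "\<dots> \<le> (real k ^ N * \<rho>) * ?q ^ k"
      using \<open>0 < \<rho>\<close> by (intro mult_right_mono schroeder_nth_le_polynomial[OF l \<open>0 < \<rho>\<close> f G N])
        (auto simp: absval_nonneg)
    finally show ?thesis
      by (simp add: mult_ac)
  qed
  ultimately show ?thesis
    by (rule fps_converges_at_if_le)
qed

text \<open>
  The identity \<open>fps_inv G oo G = fps_X\<close> expresses each coefficient of the inverse by the earlier ones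
  without any division, since the diagonal coefficients of the powers of \<open>G\<close> are \<open>1\<close>.
\<close>

lemma fps_inv_nth_le:
  fixes G :: "'a::ultrametric_field fps"
  assumes "0 < s" and G: "G $ 0 = 0" "G $ 1 = 1" "\<And>i. absval (G $ i) * s ^ i \<le> s"
  shows "absval (fps_inv G $ k) * s ^ k \<le> s"
proof (induction k rule: less_induct)
  case (less k)
  have X: "(fps_inv G oo G) $ k = fps_X $ k"
    using G by (simp add: fps_inv)
  have "(fps_inv G oo G) $ k = (\<Sum>j<k. fps_inv G $ j * (G ^ j) $ k) + fps_inv G $ k"
    using startsby_zero_power_nth_same[OF G(1), of k] G(2)
    by (simp add: fps_compose_nth atLeast0AtMost lessThan_Suc_atMost[symmetric])
  with X have eq: "fps_inv G $ k = fps_X $ k - (\<Sum>j<k. fps_inv G $ j * (G ^ j) $ k)"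
    by (simp add: algebra_simps)
  have "absval (\<Sum>j<k. fps_inv G $ j * (G ^ j) $ k) \<le> s / s ^ k"
  proof (rule absval_sum_le)
    fix j assume "j \<in> {..<k}"
    have "absval (fps_inv G $ j) * (absval ((G ^ j) $ k) * s ^ k) \<le> absval (fps_inv G $ j) * s ^ j"
      using G(3) \<open>0 < s\<close> by (intro mult_left_mono absval_fps_power_nth_le absval_nonneg) auto
    also have "\<dots> \<le> s"
      using less \<open>j \<in> {..<k}\<close> by simp
    finally show "absval (fps_inv G $ j * (G ^ j) $ k) \<le> s / s ^ k"
      using \<open>0 < s\<close> by (simp add: absval_mult field_simps)
  qed (use \<open>0 < s\<close> in simp)
  moreover have "absval (fps_X $ k :: 'a) \<le> s / s ^ k"
    using \<open>0 < s\<close> by (simp add: fps_X_def)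
  ultimately have "absval (fps_inv G $ k) \<le> s / s ^ k"
    unfolding eq by (intro order_trans[OF absval_diff_le_max]) simp
  then show ?case
    using \<open>0 < s\<close> by (simp add: field_simps)
qed

section \<open>The conjugacy\<close>

lemma nth_mult_power_le_absval:
  fixes F :: "'a::ultrametric_field fps"
  assumes "F $ 0 = 0" "0 < s" "\<And>i. absval (F $ i) * s ^ i \<le> s" "absval x < s"
  shows "absval (F $ i) * absval x ^ i \<le> (absval x / s) ^ i * s"
    and "absval (F $ i) * absval x ^ i \<le> absval x"
proof -
  have "absval (F $ i) * absval x ^ i = (absval x / s) ^ i * (absval (F $ i) * s ^ i)"
    using assms(2) by (simp add: power_divide)
  also have "\<dots> \<le> (absval x / s) ^ i * s"
    using assms by (intro mult_left_mono) (auto simp: absval_nonneg)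
  finally show le: "absval (F $ i) * absval x ^ i \<le> (absval x / s) ^ i * s" .
  show "absval (F $ i) * absval x ^ i \<le> absval x"
  proof (cases "i = 0")
    case False
    note le
    also have "(absval x / s) ^ i * s \<le> (absval x / s) ^ 1 * s"
      using False assms by (intro mult_right_mono power_decreasing) (auto simp: absval_nonneg)
    finally show ?thesis
      using assms(2) by simp
  qed (use assms(1) in \<open>simp add: absval_nonneg\<close>)
qed

text \<open>
  Series with this bound play the role of self-maps of the disc of radius \<open>s\<close> that fix the origin; the
  estimate is the ultrametric lemma of Schwarz.  It applies to \<open>f\<close> with \<open>s = \<rho>\<close> and to the inverse of
  the linearization with \<open>s = absval l * \<rho>\<close>.
\<close>

lemma fps_maps_disc:
  fixes F :: "'a::{ultrametric_field, complete_space} fps"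
  assumes "F $ 0 = 0" "0 < s" "\<And>i. absval (F $ i) * s ^ i \<le> s" "absval x < s"
  shows "fps_converges_at F x" "absval (fps_value F x) \<le> absval x"
proof -
  have "(\<lambda>i. (absval x / s) ^ i) \<longlonglongrightarrow> 0"
    using assms by (intro LIMSEQ_realpow_zero) (auto simp: absval_nonneg)
  from tendsto_mult_left_zero[OF this, of s] show conv: "fps_converges_at F x"
    by (rule fps_converges_at_if_le) (rule nth_mult_power_le_absval(1)[OF assms])
  show "absval (fps_value F x) \<le> absval x"
    by (rule absval_fps_value_le[OF conv nth_mult_power_le_absval(2)[OF assms]])
qed

text \<open>
  The Gauss norm of \<open>F\<close> at radius \<open>absval x\<close> is at most \<open>absval x\<close>, so convergence of \<open>G\<close> at \<open>x\<close> is exactly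
  what the substitution of \<open>F\<close> requires.
\<close>

lemma fps_compose_on_disc:
  fixes F G :: "'a::{ultrametric_field, complete_space} fps"
  assumes "F $ 0 = 0" "0 < s" "\<And>i. absval (F $ i) * s ^ i \<le> s" "absval x < s"
    and "fps_converges_at G x"
  shows "fps_converges_at (G oo F) x" "fps_value (G oo F) x = fps_value G (fps_value F x)"
  using fps_value_compose[OF assms(1) fps_maps_disc(1)[OF assms(1-4)]
      nth_mult_power_le_absval(2)[OF assms(1-4)], of G] assms(5)
  by (simp_all add: fps_converges_at_iff)

lemma semi_conjugacy_if_schroeder:
  fixes f G :: "'a::{ultrametric_field, complete_space} fps"
  assumes l: "0 < absval l" "absval l < 1" and "0 < \<rho>"
    and f: "f $ 0 = 0" "f $ 1 = l" "\<And>i. absval (f $ i) * \<rho> ^ i \<le> \<rho>"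
    and G: "satisfies_schroeder f l G"
  shows "semi_conjugacy f l \<rho> (restrict (fps_value G) (open_disc \<rho>))"
proof -
  let ?g = "restrict (fps_value G) (open_disc \<rho>)"
  note conv = schroeder_converges[OF l \<open>0 < \<rho>\<close> f G]
  have zero: "(0::'a) \<in> open_disc \<rho>"
    using \<open>0 < \<rho>\<close> by (simp add: open_disc_def)
  have g0: "?g 0 = 0"
    using zero G by (simp add: fps_value_0 satisfies_schroeder_def)
  have represents: "fps_represents G ?g \<rho>"
    using conv by (simp add: fps_represents_def open_disc_def)
  have "G $ 1 = 1"
    using G by (simp add: satisfies_schroeder_def)
  with fps_represents_difference_quotient_tendsto[OF at_0_neq_bot[OF l] \<open>0 < \<rho>\<close> represents]
  have deriv: "((\<lambda>x. (?g x - ?g 0) / (x - 0)) \<longlongrightarrow> 1) (at 0)"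
    by (simp only:)
  have eq: "fps_converges_at f x \<and> fps_value f x \<in> open_disc \<rho> \<and> ?g (fps_value f x) = l * ?g x"
    if "x \<in> open_disc \<rho>" for x
  proof -
    have x: "absval x < \<rho>"
      using that by (simp add: open_disc_def)
    note fx = fps_maps_disc[OF f(1) \<open>0 < \<rho>\<close> f(3) x]
    have "fps_value G (fps_value f x) = fps_value (G oo f) x"
      by (rule fps_compose_on_disc(2)[OF f(1) \<open>0 < \<rho>\<close> f(3) x conv[OF x], symmetric])
    also have "\<dots> = l * fps_value G x"
      using G fps_value_const_mult(2)[OF conv[OF x]] by (simp add: satisfies_schroeder_def)
    finally show ?thesis
      using fx x by (simp add: open_disc_def)
  qed
  from represents g0 deriv eq show ?thesis
    unfolding semi_conjugacy_def by (blast intro: restrict_extensional)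
qed

text \<open>
  A functional equation on the disc becomes one of formal power series because both \<open>G oo f\<close> and
  \<open>l * G\<close> represent the function \<open>l * g\<close> there.
\<close>

lemma schroeder_if_semi_conjugacy:
  fixes f G :: "'a::{ultrametric_field, complete_space} fps"
  assumes l: "0 < absval l" "absval l < 1" and "0 < \<rho>"
    and f: "f $ 0 = 0" "\<And>i. absval (f $ i) * \<rho> ^ i \<le> \<rho>"
    and g: "semi_conjugacy f l \<rho> g" and G: "fps_represents G g \<rho>"
  shows "satisfies_schroeder f l G"
proof -
  note nontrivial = at_0_neq_bot[OF l]
  have conv: "fps_converges_at G x" and val: "g x = fps_value G x" if "absval x < \<rho>" for x
    using G that by (auto simp: fps_represents_def open_disc_def)
  have G0: "G $ 0 = 0"
    using val[of 0] g \<open>0 < \<rho>\<close> by (simp add: fps_value_0 semi_conjugacy_def)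
  have "((\<lambda>x. (g x - g 0) / (x - 0)) \<longlongrightarrow> G $ 1) (at 0)"
    by (rule fps_represents_difference_quotient_tendsto[OF nontrivial \<open>0 < \<rho>\<close> G])
  moreover have "((\<lambda>x. (g x - g 0) / (x - 0)) \<longlongrightarrow> 1) (at 0)"
    using g unfolding semi_conjugacy_def by blast
  ultimately have G1: "G $ 1 = 1"
    using tendsto_unique[OF nontrivial] by blast
  have "fps_represents (G oo f) (\<lambda>x. l * g x) \<rho>" "fps_represents (fps_const l * G) (\<lambda>x. l * g x) \<rho>"
    unfolding fps_represents_def
  proof (safe)
    fix x :: 'a assume "x \<in> open_disc \<rho>"
    then have x: "absval x < \<rho>" and "fps_value f x \<in> open_disc \<rho>" "g (fps_value f x) = l * g x"
      using g by (auto simp: semi_conjugacy_def open_disc_def)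
    then have "l * g x = fps_value G (fps_value f x)"
      using val by (simp add: open_disc_def)
    then show "fps_converges_at (G oo f) x" "l * g x = fps_value (G oo f) x"
      using fps_compose_on_disc[OF f(1) \<open>0 < \<rho>\<close> f(2) x conv[OF x]] by simp_all
    show "fps_converges_at (fps_const l * G) x" "l * g x = fps_value (fps_const l * G) x"
      using fps_value_const_mult[OF conv[OF x]] val[OF x] by simp_all
  qed
  then have "G oo f = fps_const l * G"
    by (rule fps_represents_unique[OF nontrivial \<open>0 < \<rho>\<close>])
  with G0 G1 show ?thesis
    by (simp add: satisfies_schroeder_def)
qed

lemma full_conjugacy_if_schroeder:
  fixes f G :: "'a::{ultrametric_field, complete_space} fps"
  assumes l: "0 < absval l" "absval l < 1" and "0 < \<rho>"
    and f: "f $ 0 = 0" "f $ 1 = l" "\<And>i. absval (f $ i) * \<rho> ^ i \<le> \<rho>"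
    and G: "satisfies_schroeder f l G"
    and g: "semi_conjugacy f l \<rho> g" "fps_represents G g \<rho>"
    and x: "absval x < absval l * \<rho>"
  shows "full_conjugacy_at f l \<rho> g G x"
proof -
  let ?s = "absval l * \<rho>" and ?H = "fps_inv G"
  have s: "0 < ?s" "?s \<le> \<rho>"
    using l \<open>0 < \<rho>\<close> by (simp_all add: mult_le_cancel_right1)
  have G01: "G $ 0 = 0" "G $ 1 = 1"
    using G by (simp_all add: satisfies_schroeder_def)
  have H: "?H $ 0 = 0" "absval (?H $ i) * ?s ^ i \<le> ?s" for i
    using fps_inv_nth_le[OF s(1) G01 schroeder_nth_le_scaled_radius[OF l \<open>0 < \<rho>\<close> f G]]
    by (simp_all add: fps_inv_def)
  note Hx = fps_maps_disc[OF H(1) s(1) H(2) x]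
  have Hx_disc: "fps_value ?H x \<in> open_disc \<rho>"
    using Hx(2) x s(2) by (simp add: open_disc_def)
  have "g (fps_value ?H x) = fps_value G (fps_value ?H x)"
    using g(2) Hx_disc by (simp add: fps_represents_def)
  also have "\<dots> = fps_value (G oo ?H) x"
  proof (rule fps_compose_on_disc(2)[OF H(1) s(1) H(2) x, symmetric])
    show "fps_converges_at G x"
      using g(2) x s(2) by (simp add: fps_represents_def open_disc_def)
  qed
  also have "G oo ?H = fps_X"
    using G01 by (simp add: fps_inv_right)
  also have "fps_value fps_X x = x"
  proof -
    have "((\<lambda>n. fps_X $ n * x ^ n) has_sum x) UNIV"
      by (rule has_sum_finite_neutralI[of "{1}"]) auto
    then show ?thesis
      by (rule fps_value_unique)
  qed
  finally have "g (fps_value ?H x) = x" .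
  with g(1) Hx(1) Hx_disc show ?thesis
    unfolding semi_conjugacy_def full_conjugacy_at_def by simp
qed

theorem theorem3p1:
  fixes l :: "'a::{ultrametric_field, complete_space}"
    and \<rho> :: real
    and f :: "'a fps"
  assumes "0 < absval l" and "absval l < 1"
    and "0 < \<rho>"
    and "f \<in> power_series_family l \<rho>"
  shows "(\<exists>!g. semi_conjugacy f l \<rho> g) \<and>
         (\<forall>g G. semi_conjugacy f l \<rho> g \<and> fps_represents G g \<rho> \<longrightarrow>
            (\<forall>x. absval x < absval l * \<rho> \<longrightarrow> full_conjugacy_at f l \<rho> g G x))"
proof -
  note l = assms(1,2)
  have f: "f $ 0 = 0" "f $ 1 = l" "absval (f $ i) * \<rho> ^ i \<le> \<rho>" for i
    using assms(4) family_nth_le[OF assms(4,3,2)] by (simp_all add: power_series_family_def)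
  define G where "G = Abs_fps (schroeder_coeff f l)"
  have G: "satisfies_schroeder f l G"
    unfolding G_def using f(1,2) power_neq_self[OF l] by (rule satisfies_schroeder_Abs_fps)
  have unique: "g = restrict (fps_value G) (open_disc \<rho>)" if g: "semi_conjugacy f l \<rho> g" for g
  proof -
    obtain H where H: "fps_represents H g \<rho>"
      using g by (auto simp: semi_conjugacy_def)
    then have "satisfies_schroeder f l H"
      by (rule schroeder_if_semi_conjugacy[OF l assms(3) f(1,3) g])
    then have "H = G"
      using satisfies_schroeder_unique[OF f(1,2) power_neq_self[OF l]] G by blast
    with H g show ?thesis
      by (auto simp: semi_conjugacy_def fps_represents_def intro!: extensionalityI[of g])
  qed
  have "\<exists>!g. semi_conjugacy f l \<rho> g"
    using semi_conjugacy_if_schroeder[OF l assms(3) f G] unique by blast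
  moreover have "full_conjugacy_at f l \<rho> g H x"
    if "semi_conjugacy f l \<rho> g" "fps_represents H g \<rho>" "absval x < absval l * \<rho>" for g H x
    using schroeder_if_semi_conjugacy[OF l assms(3) f(1,3) that(1,2)] that
    by (rule full_conjugacy_if_schroeder[OF l assms(3) f])
  ultimately show ?thesis
    by blast
qed

end
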